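(* Let $X$, $Y$ and $Z$ be compact Hausdorff spaces and let $f: Z \to Y$ and $g: Z \to X$ be continuous functions. If $f$ is an open map, then $$h = \mathcal V(g) \circ f^* \circ i: Y \to \mathcal V(X), \qquad y \mapsto h(y) = g[f^{-1}(\{y\})]$$ is continuous. Moreover, for every open subset $U \subseteq X$, the equality $h^{-1}(\Diamond U) = f[g^{-1}(U)]$ holds.
   Context: For a compact Hausdorff space $X$, the Vietoris space $\mathcal V(X)$ is the set of all closed subsets of $X$ (including $\emptyset$), with the topology generated by the sets $\Diamond U = \{C \in \mathcal V(X) \mid C \cap U \neq \emptyset\}$ and $\Box U = \{C \in \mathcal V(X) \mid C \subseteq U\}$, where $U$ ranges over all open subsets of $X$. For continuous maps $f: Z \to Y$ and $g: Z \to X$ of compact Hausdorff spaces, $f^*: \mathcal V(Y) \to \mathcal V(Z)$ is the inverse image map $C \mapsto f^{-1}(C)$, and $\mathcal V(g): \mathcal V(Z) \to \mathcal V(X)$ is the forward image map $C \mapsto g[C]$. The map $i: Y \to \mathcal V(Y)$ is $y \mapsto \{y\}$. *)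

theory Defs
  imports "HOL-Analysis.Abstract_Topological_Spaces"
begin

definition vietoris_diamond :: "'a topology \<Rightarrow> 'a set \<Rightarrow> 'a set set" where
  "vietoris_diamond X U = {C. closedin X C \<and> C \<inter> U \<noteq> {}}"

definition vietoris_box :: "'a topology \<Rightarrow> 'a set \<Rightarrow> 'a set set" where
  "vietoris_box X U = {C. closedin X C \<and> C \<subseteq> U}"

text \<open>The carrier is the union of the subbasic sets; since \<open>vietoris_box X (topspace X)\<close>
  is one of them, it consists of all closed subsets of \<open>X\<close>, the empty set included.\<close>

definition vietoris :: "'a topology \<Rightarrow> 'a set topology" where
  "vietoris X = topology_generated_by
     ({vietoris_diamond X U |U. openin X U} \<union> {vietoris_box X U |U. openin X U})"

lemma topspace_vietoris: "topspace (vietoris X) = {C. closedin X C}"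
proof
  show "topspace (vietoris X) \<subseteq> {C. closedin X C}"
    by (auto simp: vietoris_def vietoris_diamond_def vietoris_box_def)
  have "{C. closedin X C} = vietoris_box X (topspace X)"
    by (auto simp: vietoris_box_def dest: closedin_subset)
  then show "{C. closedin X C} \<subseteq> topspace (vietoris X)"
    unfolding vietoris_def topology_generated_by_topspace using openin_topspace by blast
qed

definition vietoris_preimage :: "'c topology \<Rightarrow> ('c \<Rightarrow> 'b) \<Rightarrow> 'b set \<Rightarrow> 'c set" where
  "vietoris_preimage Z f C = {z \<in> topspace Z. f z \<in> C}"

definition vietoris_map :: "('c \<Rightarrow> 'a) \<Rightarrow> 'c set \<Rightarrow> 'a set" where
  "vietoris_map g C = g ` C"

definition vietoris_singleton :: "'b \<Rightarrow> 'b set" where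
  "vietoris_singleton y = {y}"

lemma vietoris_preimage_closed:
  assumes "continuous_map Z Y f" "C \<in> topspace (vietoris Y)"
  shows "vietoris_preimage Z f C \<in> topspace (vietoris Z)"
  using closedin_continuous_map_preimage[OF assms(1)] assms(2)
  by (simp add: topspace_vietoris vietoris_preimage_def)

lemma vietoris_map_closed:
  assumes "compact_space Z" "Hausdorff_space X" "continuous_map Z X g"
    and "C \<in> topspace (vietoris Z)"
  shows "vietoris_map g C \<in> topspace (vietoris X)"
proof -
  have "closed_map Z X g"
    using assms(1-3) by (simp add: continuous_imp_closed_map)
  then show ?thesis
    using assms(4) by (simp add: topspace_vietoris vietoris_map_def closed_map_def)
qed

lemma vietoris_singleton_closed:
  assumes "Hausdorff_space Y" "y \<in> topspace Y"
  shows "vietoris_singleton y \<in> topspace (vietoris Y)"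
  using assms by (simp add: topspace_vietoris vietoris_singleton_def closedin_Hausdorff_sing_eq)

end

theory Submission
  imports Defs
begin

text \<open>Being a continuous map from a compact space to a Hausdorff space, \<open>f\<close> is closed as well
  as open. The preimage of \<open>Diamond U\<close> under \<open>h\<close> is the image under \<open>f\<close> of the open set
  \<open>g\<^sup>-\<^sup>1(U)\<close>, and the preimage of \<open>Box U\<close> is the complement of the image under \<open>f\<close> of the
  closed set \<open>g\<^sup>-\<^sup>1(X - U)\<close>, so both are open.\<close>

theorem corollary3p2:
  fixes X :: "'a topology" and Y :: "'b topology" and Z :: "'c topology"
    and f :: "'c \<Rightarrow> 'b" and g :: "'c \<Rightarrow> 'a" and h :: "'b \<Rightarrow> 'a set"
  assumes "compact_space X" "Hausdorff_space X"
    and "compact_space Y" "Hausdorff_space Y"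
    and "compact_space Z" "Hausdorff_space Z"
    and "continuous_map Z Y f" "continuous_map Z X g"
    and "open_map Z Y f"
    and h_eq: "h = vietoris_map g \<circ> vietoris_preimage Z f \<circ> vietoris_singleton"
  shows "(\<forall>y\<in>topspace Y. h y = g ` {z \<in> topspace Z. f z \<in> {y}})
    \<and> continuous_map Y (vietoris X) h
    \<and> (\<forall>U. openin X U \<longrightarrow>
          {y \<in> topspace Y. h y \<in> vietoris_diamond X U} = f ` {z \<in> topspace Z. g z \<in> U})"
proof -
  have f_closed: "closed_map Z Y f"
    using assms by (simp add: continuous_imp_closed_map)
  have f_mem: "f z \<in> topspace Y" if "z \<in> topspace Z" for z
    using assms(7) that by (auto simp: continuous_map_def)
  have g_mem: "g z \<in> topspace X" if "z \<in> topspace Z" for z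
    using assms(8) that by (auto simp: continuous_map_def)
  have h_apply: "h y = g ` {z \<in> topspace Z. f z = y}" for y
    by (simp add: h_eq vietoris_map_def vietoris_preimage_def vietoris_singleton_def)
  \<comment> \<open>Diamonds and boxes contain only closed sets, so this is what reduces membership
    of \<open>h y\<close> in them to meeting \<open>U\<close> or lying inside
    \<open>U\<close>.\<close>
  have h_closed: "closedin X (h y)" if "y \<in> topspace Y" for y
    using vietoris_map_closed[OF assms(5,2,8)] vietoris_preimage_closed[OF assms(7)]
      vietoris_singleton_closed[OF assms(4) that]
    by (simp add: h_eq topspace_vietoris)
  have diamond: "{y \<in> topspace Y. h y \<in> vietoris_diamond X U} = f ` {z \<in> topspace Z. g z \<in> U}" for U
    using h_closed f_mem unfolding vietoris_diamond_def h_apply by blast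
  \<comment> \<open>\<open>h y\<close> leaves \<open>U\<close> exactly when the fibre over
    \<open>y\<close> has a point that \<open>g\<close> sends outside \<open>U\<close>; by
    \<open>g_mem\<close> its image lies in \<open>topspace X - U\<close>.\<close>
  have box: "{y \<in> topspace Y. h y \<in> vietoris_box X U}
      = topspace Y - f ` {z \<in> topspace Z. g z \<in> topspace X - U}" for U
    using h_closed g_mem unfolding vietoris_box_def h_apply by blast
  have diamond_open: "openin Y {y \<in> topspace Y. h y \<in> vietoris_diamond X U}" if "openin X U" for U
    unfolding diamond using assms(9) openin_continuous_map_preimage[OF assms(8) that]
    by (simp add: open_map_def)
  have box_open: "openin Y {y \<in> topspace Y. h y \<in> vietoris_box X U}" if "openin X U" for U
  proof -
    have "closedin Z {z \<in> topspace Z. g z \<in> topspace X - U}"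
      using that by (intro closedin_continuous_map_preimage[OF assms(8)]) auto
    then show ?thesis
      unfolding box using f_closed by (intro openin_diff) (auto simp: closed_map_def)
  qed
  have "continuous_map Y (vietoris X) h"
    unfolding vietoris_def
  proof (rule continuous_on_generated_topo)
    fix S assume "S \<in> {vietoris_diamond X U |U. openin X U} \<union> {vietoris_box X U |U. openin X U}"
    then have "openin Y {y \<in> topspace Y. h y \<in> S}"
      using diamond_open box_open by blast
    also have "{y \<in> topspace Y. h y \<in> S} = h -` S \<inter> topspace Y"
      by blast
    finally show "openin Y (h -` S \<inter> topspace Y)" .
  next
    \<comment> \<open>The union of the generators is the carrier of \<open>vietoris X\<close>, that
      is, all closed sets, so \<open>h_closed\<close> suffices.\<close>
    show "h ` topspace Y
        \<subseteq> \<Union> ({vietoris_diamond X U |U. openin X U} \<union> {vietoris_box X U |U. openin X U})"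
      using h_closed topspace_vietoris[of X]
      unfolding vietoris_def topology_generated_by_topspace by blast
  qed
  with diamond h_apply show ?thesis
    by simp
qed

end
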